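(* Let $v\in C_0^\infty(\mathbb{R}^2)$ be any function, $v\not\equiv0$, and let $u=J_0(|x|)\,v$. Then $$\int_{\mathbb{R}^2}|\nabla u|^2\,dx>\int_{\mathbb{R}^2}u^2\,dx .$$ The best constant in this inequality (the largest constant $C$ such that the inequality with right-hand side $C\int_{\mathbb{R}^2}u^2\,dx$ holds for all such $u$) is $1$, and there exists no minimizer.
   Context: $J_0$ is the Bessel function of the first kind of order $0$, normalized by $J_0(0)=1$. "Minimizer" refers to the quotient $\int|\nabla u|^2/\int u^2$ over functions $u$ of the form $u=J_0(|x|)\,v$ with $v\in C_0^\infty(\mathbb{R}^2)$, $v\not\equiv0$. *)

theory Defs
  imports "HOL-Analysis.Analysis"
begin

definition bessel_J0 :: "real \<Rightarrow> real" where
  "bessel_J0 r = (\<Sum>k. (-1) ^ k / (fact k)\<^sup>2 * (r / 2) ^ (2 * k))"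

fun C_k :: "nat \<Rightarrow> ('a::real_normed_vector \<Rightarrow> real) \<Rightarrow> bool" where
  "C_k 0 f \<longleftrightarrow> continuous_on UNIV f"
| "C_k (Suc k) f \<longleftrightarrow>
     (\<forall>x. f differentiable (at x)) \<and> (\<forall>h. C_k k (\<lambda>x. frechet_derivative f (at x) h))"

definition smooth :: "('a::real_normed_vector \<Rightarrow> real) \<Rightarrow> bool" where
  "smooth f \<longleftrightarrow> (\<forall>k. C_k k f)"

definition test_functions :: "('a::real_normed_vector \<Rightarrow> real) set" where
  "test_functions = {v. smooth v \<and> compact (closure (support_on UNIV v))}"

(* The functions J_0(|x|) v(x), with v a test function that is not identically zero. *)
definition admissible :: "(real^2 \<Rightarrow> real) set" where
  "admissible =
     {\<lambda>x. bessel_J0 (norm x) * v x | v. v \<in> test_functions \<and> (\<exists>x. v x \<noteq> 0)}"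

definition gradient :: "('a::real_inner \<Rightarrow> real) \<Rightarrow> 'a \<Rightarrow> 'a" where
  "gradient f x = (THE D. GDERIV f x :> D)"

(* Admissible functions are smooth (J_0 is an even entire function) and compactly supported,
   so the Bochner integrals below are genuine, and never the default value 0 given to
   non-integrable functions. *)
definition dirichlet_energy :: "(real^2 \<Rightarrow> real) \<Rightarrow> real" where
  "dirichlet_energy u = (LINT x|lborel. (norm (gradient u x))\<^sup>2)"

definition mass :: "(real^2 \<Rightarrow> real) \<Rightarrow> real" where
  "mass u = (LINT x|lborel. (u x)\<^sup>2)"

definition is_best_constant :: "real \<Rightarrow> bool" where
  "is_best_constant C \<longleftrightarrow>
     (\<forall>u\<in>admissible. dirichlet_energy u > C * mass u) \<and>
     (\<forall>C'. (\<forall>u\<in>admissible. dirichlet_energy u > C' * mass u) \<longrightarrow> C' \<le> C)"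

definition is_minimizer :: "(real^2 \<Rightarrow> real) \<Rightarrow> bool" where
  "is_minimizer u \<longleftrightarrow>
     u \<in> admissible \<and>
     (\<forall>w\<in>admissible. dirichlet_energy u / mass u \<le> dirichlet_energy w / mass w)"

end

theory Submission
  imports Defs
begin

text \<open>
  The function \<open>\<phi>(x) = J\<^sub>0(norm x)\<close> solves \<open>\<Delta>\<phi> = -\<phi>\<close> in the plane. Writing \<open>u = \<phi> v\<close> and
  integrating by parts gives the identity
  \<open>\<integral>|\<nabla>u|\<^sup>2 = \<integral>u\<^sup>2 + \<integral>\<phi>\<^sup>2|\<nabla>v|\<^sup>2\<close> (lemma \<open>divergence_identity\<close>). The last integral is nonnegative.
  It is positive for \<open>v\<close> nonzero: the zero set of \<open>\<phi>\<close> has empty interior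
  (\<open>\<phi>_zero_set_no_interior\<close>), so its vanishing would force \<open>\<nabla>v = 0\<close> everywhere, and a constant
  with compact support is zero. This is the strict inequality (\<open>energy_gt_mass\<close>).

  For the sharpness of the constant, \<open>v\<close> is taken to be a bump function \<open>\<eta>(x/R)\<close>. The excess
  \<open>\<integral>\<phi>\<^sup>2|\<nabla>v|\<^sup>2\<close> is at most a multiple of \<open>R\<^sup>-\<^sup>2 M(R)\<close>, and \<open>\<integral>u\<^sup>2\<close> is at least a multiple of \<open>M(R/2)\<close>,
  where \<open>M(R)\<close> is the integral of \<open>\<phi>\<^sup>2\<close> over the disc of radius \<open>R\<close>. If the quotient of the two
  stayed bounded below, \<open>M\<close> would grow faster than any power of \<open>R\<close>; but \<open>|\<phi>| \<le> 1\<close> bounds \<open>M(R)\<close>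
  by the area of the disc (\<open>almost_minimizing_bump\<close>). No asymptotic expansion of the Bessel
  function is involved: both \<open>|\<phi>| \<le> 1\<close> and the simplicity of the zeros of \<open>\<phi>\<close> follow from the
  monotonicity of an energy of the Bessel equation.

  A minimizer would have a quotient \<open>q > 1\<close> that bounds all other quotients from below, which
  contradicts the sharpness of the constant \<open>1\<close>.
\<close>

section \<open>The Bessel function as a power series in the squared radius\<close>

text \<open>
  Passing to the variable \<open>s = r\<^sup>2\<close> removes the square root in \<open>J\<^sub>0(norm x)\<close>, so that the
  function on the plane is visibly smooth at the origin. \<open>G1\<close> and \<open>G2\<close> below are the
  first two derivatives of \<open>G0\<close>, with \<open>J\<^sub>0(r) = G0(r\<^sup>2)\<close>.
\<close>

definition bessel_coeff :: "nat \<Rightarrow> real" where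
  "bessel_coeff k = (-1) ^ k / ((fact k)\<^sup>2 * 4 ^ k)"

definition G0 :: "real \<Rightarrow> real" where
  "G0 s = (\<Sum>k. bessel_coeff k * s ^ k)"

definition G1 :: "real \<Rightarrow> real" where
  "G1 s = (\<Sum>k. diffs bessel_coeff k * s ^ k)"

definition G2 :: "real \<Rightarrow> real" where
  "G2 s = (\<Sum>k. diffs (diffs bessel_coeff) k * s ^ k)"

lemma bessel_J0_eq_G0: "bessel_J0 (norm x) = G0 (x \<bullet> x)"
proof -
  have "(-1) ^ k / (fact k)\<^sup>2 * (norm x / 2) ^ (2 * k) = bessel_coeff k * (x \<bullet> x) ^ k" for k
    by (simp add: bessel_coeff_def power_mult power_divide dot_square_norm)
  then show ?thesis
    unfolding bessel_J0_def G0_def by simp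
qed

lemma summable_bessel: "summable (\<lambda>k. bessel_coeff k * s ^ k)"
proof (rule summable_comparison_test')
  show "summable (\<lambda>k. \<bar>s\<bar> ^ k /\<^sub>R fact k)"
    by (rule summable_exp_generic)
next
  fix k :: nat
  have "(1::real) * fact k \<le> ((fact k) * 4 ^ k) * fact k"
    by (intro mult_right_mono) (use mult_mono[of "1::real" "fact k" 1 "4 ^ k"] in auto)
  then have "(fact k :: real) \<le> (fact k)\<^sup>2 * 4 ^ k"
    by (simp add: power2_eq_square mult_ac)
  then have "\<bar>s\<bar> ^ k / ((fact k)\<^sup>2 * 4 ^ k) \<le> \<bar>s\<bar> ^ k / fact k"
    by (intro divide_left_mono) auto
  then show "norm (bessel_coeff k * s ^ k) \<le> \<bar>s\<bar> ^ k /\<^sub>R fact k"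
    by (simp add: bessel_coeff_def abs_mult power_abs divide_inverse mult_ac)
qed

lemma summable_diffs_bessel: "summable (\<lambda>k. diffs bessel_coeff k * s ^ k)"
  by (rule termdiff_converges_all) (rule summable_bessel)

lemma summable_diffs_diffs_bessel: "summable (\<lambda>k. diffs (diffs bessel_coeff) k * s ^ k)"
  by (rule termdiff_converges_all) (rule summable_diffs_bessel)

lemma DERIV_G0: "(G0 has_real_derivative G1 s) (at s)"
  unfolding G0_def[abs_def] G1_def
  by (rule termdiffs_strong_converges_everywhere) (rule summable_bessel)

lemma DERIV_G1: "(G1 has_real_derivative G2 s) (at s)"
  unfolding G1_def[abs_def] G2_def
  by (rule termdiffs_strong_converges_everywhere) (rule summable_diffs_bessel)

lemma isCont_G0: "isCont G0 s" using DERIV_G0 DERIV_isCont by blast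
lemma isCont_G1: "isCont G1 s" using DERIV_G1 DERIV_isCont by blast
lemma isCont_G2: "isCont G2 s"
proof -
  have "((\<lambda>x. \<Sum>k. diffs (diffs bessel_coeff) k * x ^ k) has_real_derivative
     (\<Sum>k. diffs (diffs (diffs bessel_coeff)) k * s ^ k)) (at s)"
    by (rule termdiffs_strong_converges_everywhere) (rule summable_diffs_diffs_bessel)
  then show ?thesis
    unfolding G2_def[abs_def] by (rule DERIV_isCont)
qed

lemma continuous_on_G [continuous_intros]:
  assumes "continuous_on A q"
  shows "continuous_on A (\<lambda>x. G0 (q x))" "continuous_on A (\<lambda>x. G1 (q x))"
    "continuous_on A (\<lambda>x. G2 (q x))"
  using assms isCont_G0 isCont_G1 isCont_G2
  by (auto intro!: continuous_on_compose2[of UNIV _ A q] continuous_at_imp_continuous_on)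

lemma G0_0: "G0 0 = 1"
  using powser_zero[of bessel_coeff] by (simp add: G0_def bessel_coeff_def)

text \<open>
  Bessel's equation \<open>J'' + J'/r + J = 0\<close> in the variable \<open>s = r\<^sup>2\<close>. For the plane it says
  that \<open>\<Delta>\<phi> = -\<phi>\<close>. It reduces to the recursion \<open>4(n+1)\<^sup>2 c\<^sub>n\<^sub>+\<^sub>1 = -c\<^sub>n\<close> of the coefficients.
\<close>

lemma bessel_ODE: "4 * s * G2 s + 4 * G1 s + G0 s = 0"
proof -
  have "(\<lambda>n. of_nat n * diffs bessel_coeff n * s ^ (n - Suc 0)) sums G2 s"
    unfolding G2_def by (rule diffs_equiv) (rule summable_diffs_diffs_bessel)
  from sums_mult[OF this, of s]
  have "(\<lambda>n. of_nat n * diffs bessel_coeff n * s ^ n) sums (s * G2 s)"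
    by (rule sums_cong[THEN iffD1, rotated]) (case_tac n, auto)
  moreover have "(\<lambda>n. diffs bessel_coeff n * s ^ n) sums G1 s"
    unfolding G1_def by (rule summable_sums) (rule summable_diffs_bessel)
  moreover have "(\<lambda>n. bessel_coeff n * s ^ n) sums G0 s"
    unfolding G0_def by (rule summable_sums) (rule summable_bessel)
  ultimately have S: "(\<lambda>n. 4 * (of_nat n * diffs bessel_coeff n * s ^ n)
      + 4 * (diffs bessel_coeff n * s ^ n) + bessel_coeff n * s ^ n)
      sums (4 * (s * G2 s) + 4 * G1 s + G0 s)"
    by (intro sums_add sums_mult)
  have "4 * (of_nat n * diffs bessel_coeff n) + 4 * diffs bessel_coeff n + bessel_coeff n = 0" for n
  proof -
    have "bessel_coeff n = - (4 * (of_nat n + 1)\<^sup>2 * bessel_coeff (Suc n))"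
      by (simp add: bessel_coeff_def divide_simps power2_eq_square del: of_nat_Suc)
        (simp add: algebra_simps)
    then show ?thesis by (simp add: diffs_def algebra_simps power2_eq_square)
  qed
  then have "4 * (of_nat n * diffs bessel_coeff n * s ^ n)
      + 4 * (diffs bessel_coeff n * s ^ n) + bessel_coeff n * s ^ n = 0" for n
    by (simp only: mult.assoc[symmetric] distrib_right[symmetric])
  with S show ?thesis
    by (simp add: sums_iff mult.assoc)
qed

text \<open>
  In the variable \<open>r\<close> this is \<open>J\<^sup>2 + J'\<^sup>2\<close>, the energy of the damped oscillation that
  Bessel's equation describes. It decreases, which bounds \<open>J\<close>; but so slowly that
  \<open>s\<close> times it increases, which prevents \<open>J\<close> and \<open>J'\<close> from vanishing together.
\<close>

definition bessel_energy :: "real \<Rightarrow> real" where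
  "bessel_energy s = (G0 s)\<^sup>2 + 4 * s * (G1 s)\<^sup>2"

lemma DERIV_bessel_energy: "(bessel_energy has_real_derivative - 4 * (G1 s)\<^sup>2) (at s)"
proof -
  have "(bessel_energy has_real_derivative
      2 * G0 s * G1 s + (4 * (G1 s)\<^sup>2 + 4 * s * (2 * G1 s * G2 s))) (at s)"
    unfolding bessel_energy_def[abs_def]
    by (auto intro!: derivative_eq_intros DERIV_G0 DERIV_G1)
  moreover have "2 * G0 s * G1 s + (4 * (G1 s)\<^sup>2 + 4 * s * (2 * G1 s * G2 s))
      = 2 * G1 s * (4 * s * G2 s + 4 * G1 s + G0 s) - 4 * (G1 s)\<^sup>2"
    by (simp add: algebra_simps power2_eq_square)
  ultimately show ?thesis by (simp only: bessel_ODE) simp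
qed

lemma G0_square_le_1:
  assumes "0 \<le> s"
  shows "(G0 s)\<^sup>2 \<le> 1"
proof -
  have "bessel_energy s \<le> bessel_energy 0"
    by (rule DERIV_nonpos_imp_nonincreasing[OF assms]) (use DERIV_bessel_energy in force)
  moreover have "(G0 s)\<^sup>2 \<le> bessel_energy s"
    using assms by (simp add: bessel_energy_def)
  ultimately show ?thesis by (simp add: bessel_energy_def G0_0)
qed

text \<open>
  At a common zero the increasing function \<open>t * bessel_energy t\<close> would vanish, hence be
  nonpositive before it; then \<open>G0\<close> would be zero on a whole interval ending at \<open>0\<close>, against
  \<open>G0 0 = 1\<close>.
\<close>

lemma G0_G1_no_common_zero:
  assumes "0 < s" "G0 s = 0" "G1 s = 0"
  shows False
proof -
  have D: "((\<lambda>t. t * bessel_energy t) has_real_derivative (G0 t)\<^sup>2) (at t)" for t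
    by (rule derivative_eq_intros DERIV_bessel_energy refl)+ (simp add: bessel_energy_def)
  have zero: "G0 t = 0" if "0 < t" "t \<le> s" for t
  proof -
    have "t * bessel_energy t \<le> s * bessel_energy s"
      by (rule DERIV_nonneg_imp_nondecreasing[OF that(2)]) (use D in force)
    then have "bessel_energy t \<le> 0"
      using assms that by (simp add: bessel_energy_def mult_le_0_iff)
    moreover have "0 \<le> t * (G1 t)\<^sup>2" using that by simp
    ultimately have "(G0 t)\<^sup>2 \<le> 0" unfolding bessel_energy_def by linarith
    then show ?thesis by simp
  qed
  have "(G0 \<longlongrightarrow> G0 0) (at_right 0)"
    using isCont_G0[of 0] by (simp add: isCont_def filterlim_at_split)
  moreover have "\<forall>\<^sub>F t in at_right 0. G0 t = 0"
    using eventually_at_right_real[OF assms(1)]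
    by eventually_elim (simp add: zero)
  then have "(G0 \<longlongrightarrow> 0) (at_right 0)"
    by (rule tendsto_eventually)
  ultimately show False
    using tendsto_unique[of "at_right (0::real)" G0] G0_0 by fastforce
qed

definition \<phi> :: "'a::real_inner \<Rightarrow> real" where
  "\<phi> x = G0 (x \<bullet> x)"

lemma has_derivative_\<phi>: "(\<phi> has_derivative (\<lambda>h. 2 * G1 (x \<bullet> x) * (x \<bullet> h))) (at x)"
proof -
  have "((\<lambda>x. x \<bullet> x) has_derivative (\<lambda>h. 2 * (x \<bullet> h))) (at x)"
    by (rule derivative_eq_intros refl)+ (simp add: inner_commute)
  from DERIV_compose_FDERIV[OF DERIV_G0 this] show ?thesis
    unfolding \<phi>_def[abs_def] by (simp add: mult_ac)
qed

lemma continuous_\<phi>: "continuous_on UNIV \<phi>"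
  unfolding \<phi>_def[abs_def] by (intro continuous_intros)

text \<open>
  On an open set of zeros the gradient would vanish too, but the zeros of \<open>\<phi>\<close> are simple.
\<close>

lemma \<phi>_zero_set_no_interior:
  assumes "open U" "x \<in> U"
  obtains y where "y \<in> U" "\<phi> y \<noteq> 0"
proof (rule ccontr)
  assume "\<not> thesis"
  with that have z: "\<phi> y = 0" if "y \<in> U" for y using \<open>y \<in> U\<close> by blast
  have "(\<phi> has_derivative (\<lambda>h. 0)) (at x)"
    by (rule has_derivative_transform_within_open[OF has_derivative_const[of 0] assms])
      (simp add: z)
  from has_derivative_unique[OF this has_derivative_\<phi>]
  have "2 * G1 (x \<bullet> x) * (x \<bullet> x) = 0" by (rule fun_cong[symmetric])
  moreover have "G0 (x \<bullet> x) = 0" using z[OF assms(2)] by (simp add: \<phi>_def)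
  moreover from this have "x \<bullet> x \<noteq> 0" using G0_0 by auto
  ultimately show False
    using G0_G1_no_common_zero[of "x \<bullet> x"] by auto
qed

section \<open>Integrals of compactly supported functions\<close>

lemma integrable_continuous_bounded_support:
  fixes f :: "'a::euclidean_space \<Rightarrow> real"
  assumes "continuous_on UNIV f" "\<And>x. B < norm x \<Longrightarrow> f x = 0"
  shows "integrable lborel f"
proof -
  have "integrable lborel (\<lambda>x. indicator (cball 0 B) x *\<^sub>R f x)"
    by (rule borel_integrable_compact) (use assms(1) continuous_on_subset in auto)
  moreover have "(\<lambda>x. indicator (cball 0 B) x *\<^sub>R f x) = f"
    using assms(2) by (force simp: indicator_def)
  ultimately show ?thesis by simp
qed

text \<open>
  The form of the divergence theorem that is needed: the integral of \<open>f(x + t h)\<close> over the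
  whole space does not depend on \<open>t\<close>, so its derivative at \<open>t = 0\<close>, taken under the integral
  sign, vanishes.
\<close>

lemma integral_directional_derivative_eq_0:
  fixes f :: "'a::euclidean_space \<Rightarrow> real"
  assumes der: "\<And>x. (f has_derivative f' x) (at x)"
    and cont: "continuous_on UNIV (\<lambda>x. f' x h)"
    and supp: "\<And>x. B < norm x \<Longrightarrow> f x = 0"
  shows "integrable lborel (\<lambda>x. f' x h)" "(LINT x|lborel. f' x h) = 0"
proof -
  have contf: "continuous_on UNIV f"
    using der has_derivative_continuous continuous_at_imp_continuous_on by blast
  have supp': "f' x h = 0" if "B < norm x" for x
  proof -
    have "open {y::'a. B < norm y}"
      by (intro open_Collect_less continuous_intros)
    then have "(f has_derivative (\<lambda>h. 0)) (at x)"
      by (rule has_derivative_transform_within_open[OF has_derivative_const[of 0]])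
        (use that supp in auto)
    from has_derivative_unique[OF this der] show ?thesis by metis
  qed
  show "integrable lborel (\<lambda>x. f' x h)"
    by (rule integrable_continuous_bounded_support[OF cont supp'])
  have intf: "integrable lborel f"
    by (rule integrable_continuous_bounded_support[OF contf supp])
  have "bounded ((\<lambda>x. f' x h) ` cball 0 B)"
    by (intro compact_imp_bounded compact_continuous_image continuous_on_subset[OF cont]) auto
  then obtain K0 where "\<forall>x\<in>cball 0 B. \<bar>f' x h\<bar> \<le> K0"
    by (auto simp: bounded_iff)
  then have K0: "\<And>x. norm x \<le> B \<Longrightarrow> \<bar>f' x h\<bar> \<le> K0"
    by simp
  define K where "K = max K0 0"
  have K: "\<bar>f' x h\<bar> \<le> K" for x
    using K0[of x] supp'[of x] by (cases "norm x \<le> B") (auto simp: K_def)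
  \<comment> \<open>The difference quotients along \<open>h\<close> with step \<open>1/(n+1)\<close>; each has integral 0, and they
    are dominated because the mean value theorem bounds them by a bound of \<open>f'\<close>.\<close>
  define q where "q n x = real (Suc n) * (f (x + (1 / real (Suc n)) *\<^sub>R h) - f x)" for n x
  have shift: "integrable lborel (\<lambda>x. f (x + c)) \<and> (LINT x|lborel. f (x + c)) = (LINT x|lborel. f x)" for c
  proof -
    have m: "f \<in> borel_measurable borel" using contf by (rule borel_measurable_continuous_onI)
    have "integrable (distr lborel borel ((+) c)) f"
      using intf by (simp add: lborel_distr_plus)
    then have "integrable lborel (\<lambda>x. f (c + x))"
      by (subst (asm) integrable_distr_eq) (use m in auto)
    moreover have "(LINT x|distr lborel borel ((+) c). f x) = (LINT x|lborel. f (c + x))"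
      by (rule integral_distr) (use m in auto)
    ultimately show ?thesis by (simp add: lborel_distr_plus add.commute)
  qed
  have q0: "(LINT x|lborel. q n x) = 0" for n
    unfolding q_def using shift intf by simp
  have lim: "(\<lambda>n. q n x) \<longlonglongrightarrow> f' x h" for x
  proof -
    have "((\<lambda>t. f (x + t *\<^sub>R h)) has_real_derivative f' x h) (at 0)"
    proof -
      have "((\<lambda>t. f (x + t *\<^sub>R h)) has_derivative (\<lambda>t. f' x (t *\<^sub>R h))) (at 0)"
        by (rule has_derivative_compose[where f = "\<lambda>t. x + t *\<^sub>R h" and g = f, simplified])
          (auto intro!: derivative_eq_intros der)
      moreover have "f' x (t *\<^sub>R h) = f' x h * t" for t
        using linear_scale[OF has_derivative_linear[OF der]] by simp
      ultimately show ?thesis by (simp add: has_field_derivative_def)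
    qed
    then have "(\<lambda>t. (f (x + t *\<^sub>R h) - f x) / t) \<midarrow>0\<rightarrow> f' x h"
      by (simp add: DERIV_def)
    moreover have "filterlim (\<lambda>n. 1 / real (Suc n)) (at 0) sequentially"
      using LIMSEQ_Suc[OF lim_1_over_n] by (auto simp: filterlim_at)
    ultimately have "(\<lambda>n. (f (x + (1 / real (Suc n)) *\<^sub>R h) - f x) / (1 / real (Suc n))) \<longlonglongrightarrow> f' x h"
      by (rule filterlim_compose)
    then show ?thesis by (simp add: q_def mult.commute)
  qed
  have bound: "norm (q n x) \<le> K * indicator (cball 0 (B + norm h)) x" for n x
  proof (cases "norm x \<le> B + norm h")
    case True
    let ?t = "1 / real (Suc n)"
    have D: "((\<lambda>t. f (x + t *\<^sub>R h)) has_real_derivative f' (x + t *\<^sub>R h) h) (at t)" for t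
    proof -
      have "((\<lambda>t. f (x + t *\<^sub>R h)) has_derivative (\<lambda>s. f' (x + t *\<^sub>R h) (s *\<^sub>R h))) (at t)"
        by (rule has_derivative_compose[where f = "\<lambda>t. x + t *\<^sub>R h" and g = f, simplified])
          (auto intro!: derivative_eq_intros der)
      moreover have "f' y (s *\<^sub>R h) = f' y h * s" for y s
        using linear_scale[OF has_derivative_linear[OF der]] by simp
      ultimately show ?thesis by (simp add: has_field_derivative_def)
    qed
    obtain z where "f (x + ?t *\<^sub>R h) - f (x + 0 *\<^sub>R h) = (?t - 0) * f' (x + z *\<^sub>R h) h"
      using MVT2[of 0 ?t "\<lambda>t. f (x + t *\<^sub>R h)" "\<lambda>t. f' (x + t *\<^sub>R h) h"] D by auto
    then have "q n x = f' (x + z *\<^sub>R h) h"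
      by (simp add: q_def divide_simps mult.commute del: of_nat_Suc)
    then show ?thesis using K True by simp
  next
    case False
    have "norm ((1 / real (Suc n)) *\<^sub>R h) \<le> norm h"
      by (simp add: divide_simps) (simp add: algebra_simps)
    moreover have "norm x \<le> norm (x + (1 / real (Suc n)) *\<^sub>R h) + norm ((1 / real (Suc n)) *\<^sub>R h)"
      using norm_triangle_ineq4[of "x + (1 / real (Suc n)) *\<^sub>R h" "(1 / real (Suc n)) *\<^sub>R h"]
      by (simp only: add_diff_cancel)
    ultimately have "B < norm (x + (1 / real (Suc n)) *\<^sub>R h)" "B < norm x"
      using False norm_ge_zero[of h] by linarith+
    then show ?thesis using supp False by (simp add: q_def)
  qed
  have meas: "q n \<in> borel_measurable lborel" for n
    unfolding q_def[abs_def] using shift intf by (simp add: borel_measurable_integrable)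
  have "(\<lambda>n. LINT x|lborel. q n x) \<longlonglongrightarrow> (LINT x|lborel. f' x h)"
  proof (rule integral_dominated_convergence)
    show "(\<lambda>x. f' x h) \<in> borel_measurable lborel"
      using borel_measurable_continuous_onI[OF cont] by simp
    show "integrable lborel (\<lambda>x. K * indicator (cball 0 (B + norm h)) x)"
      by (intro integrable_mult_right integrable_real_indicator) (use emeasure_lborel_cball_finite in auto)
  qed (use lim bound meas in auto)
  then show "(LINT x|lborel. f' x h) = 0"
    using q0 by (simp add: LIMSEQ_const_iff)
qed

lemma continuous_nonneg_integral_eq_0:
  fixes f :: "'a::euclidean_space \<Rightarrow> real"
  assumes cont: "continuous_on UNIV f" and nonneg: "\<And>x. 0 \<le> f x"
    and int: "integrable lborel f" and "(LINT x|lborel. f x) = 0"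
  shows "f x = 0"
proof (rule ccontr)
  assume "f x \<noteq> 0"
  define U where "U = {x. 0 < f x}"
  have U: "open U" "x \<in> U"
    unfolding U_def using cont nonneg[of x] \<open>f x \<noteq> 0\<close>
    by (auto intro!: open_Collect_less continuous_intros)
  have "AE x in lborel. f x = 0"
    using integral_nonneg_eq_0_iff_AE[OF int] nonneg assms(4) by auto
  then have "AE x in lborel. x \<notin> U"
    by eventually_elim (simp add: U_def)
  then have "U \<in> null_sets lborel"
    using U(1) by (subst AE_iff_null_sets) auto
  then have "negligible U"
    using U(1) by (simp add: negligible_iff_null_sets null_sets_completionI)
  with open_not_negligible[OF U(1)] U(2) show False by auto
qed

text \<open>
  The weight \<open>\<phi>\<^sup>2\<close> has zeros, but not enough of them to hide an open set on which \<open>f\<close> is positive.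
\<close>

lemma continuous_nonneg_\<phi>_integral_eq_0:
  fixes f :: "'a::euclidean_space \<Rightarrow> real"
  assumes cont: "continuous_on UNIV f" and nonneg: "\<And>x. 0 \<le> f x"
    and supp: "\<And>x. B < norm x \<Longrightarrow> f x = 0"
    and int0: "(LINT x|lborel. (\<phi> x)\<^sup>2 * f x) = 0"
  shows "f x = 0"
proof (rule ccontr)
  assume "f x \<noteq> 0"
  have c: "continuous_on UNIV (\<lambda>x. (\<phi> x)\<^sup>2 * f x)"
    by (intro continuous_intros continuous_\<phi> cont)
  have "integrable lborel (\<lambda>x. (\<phi> x)\<^sup>2 * f x)"
    by (rule integrable_continuous_bounded_support[OF c, of B]) (simp add: supp)
  then have "(\<phi> y)\<^sup>2 * f y = 0" for y
    by (intro continuous_nonneg_integral_eq_0[OF c _ _ int0]) (simp_all add: nonneg)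
  then have z: "\<phi> y = 0" if "f y \<noteq> 0" for y using that by fastforce
  have "open {y. f y \<noteq> 0}"
    by (intro open_Collect_neq cont continuous_intros)
  then show False
    using \<phi>_zero_set_no_interior[of "{y. f y \<noteq> 0}" x] z \<open>f x \<noteq> 0\<close> by blast
qed

section \<open>Gradients and the energy identity\<close>

lemma gradient_eqI:
  assumes "(f has_derivative (\<lambda>h. h \<bullet> D)) (at x)"
  shows "gradient f x = D"
  unfolding gradient_def
proof (rule the_equality)
  show "GDERIV f x :> D" using assms by (simp add: gderiv_def)
  fix D' assume "GDERIV f x :> D'"
  then have "(\<lambda>h. h \<bullet> D') = (\<lambda>h. h \<bullet> D)"
    unfolding gderiv_def using assms by (rule has_derivative_unique)
  then show "D' = D" by (simp add: fun_eq_iff vector_eq_ldot)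
qed

lemma has_derivative_gradient:
  fixes f :: "'a::euclidean_space \<Rightarrow> real"
  assumes "f differentiable (at x)"
  shows "(f has_derivative (\<lambda>h. h \<bullet> gradient f x)) (at x)"
proof -
  obtain f' where f': "(f has_derivative f') (at x)"
    using assms by (auto simp: differentiable_def)
  then interpret linear f' by (rule has_derivative_linear)
  have "f' = (\<lambda>h. h \<bullet> adjoint f' 1)"
    using adjoint_works[OF linear_axioms, of _ 1] by (auto simp: inner_real_def)
  with f' have "(f has_derivative (\<lambda>h. h \<bullet> adjoint f' 1)) (at x)" by simp
  with gradient_eqI[OF this] show ?thesis by simp
qed

lemma test_function_C1:
  fixes v :: "'a::euclidean_space \<Rightarrow> real"
  assumes "v \<in> test_functions"
  shows "v differentiable (at x)" "continuous_on UNIV (gradient v)"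
proof -
  have "C_k (Suc 0) v"
    using assms by (auto simp: test_functions_def smooth_def simp del: C_k.simps)
  then have d: "\<And>x. v differentiable (at x)"
    and c: "\<And>h. continuous_on UNIV (\<lambda>x. frechet_derivative v (at x) h)"
    by auto
  show "v differentiable (at x)" by (rule d)
  have "frechet_derivative v (at x) h = h \<bullet> gradient v x" for x h
    using has_derivative_gradient[OF d] frechet_derivative_at by metis
  with c show "continuous_on UNIV (gradient v)"
    by (subst continuous_on_componentwise) (simp add: inner_commute)
qed

lemma test_function_bounded_support:
  assumes "v \<in> test_functions"
  obtains B where "\<And>x. B < norm x \<Longrightarrow> v x = 0"
proof -
  have "bounded (support_on UNIV v)"
    using assms bounded_subset[OF compact_imp_bounded closure_subset]
    by (auto simp: test_functions_def)
  then obtain B where "\<forall>x\<in>support_on UNIV v. norm x \<le> B"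
    by (auto simp: bounded_iff)
  then show thesis
    by (intro that[of B]) (auto simp: support_on_def not_le[symmetric])
qed

lemma gradient_eq_0_outside:
  fixes v :: "'a::euclidean_space \<Rightarrow> real"
  assumes "\<And>x. B < norm x \<Longrightarrow> v x = 0" "B < norm x"
  shows "gradient v x = 0"
proof (rule gradient_eqI)
  have "open {y::'a. B < norm y}"
    by (intro open_Collect_less continuous_intros)
  then have "(v has_derivative (\<lambda>h. 0)) (at x)"
    by (rule has_derivative_transform_within_open[OF has_derivative_const[of 0]])
      (use assms in auto)
  then show "(v has_derivative (\<lambda>h. h \<bullet> 0)) (at x)" by simp
qed

text \<open>
  The ground state substitution \<open>u = \<phi> v\<close>. Pointwise,
  \<open>|\<nabla>u|\<^sup>2 = \<phi>\<^sup>2|\<nabla>v|\<^sup>2 + \<nabla>\<phi> \<bullet> \<nabla>(\<phi> v\<^sup>2)\<close>, and the last term is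
  \<open>div (\<phi> v\<^sup>2 \<nabla>\<phi>) - \<phi> v\<^sup>2 \<Delta>\<phi> = div (\<phi> v\<^sup>2 \<nabla>\<phi>) + u\<^sup>2\<close>. The divergence integrates to zero.
\<close>

lemma divergence_identity:
  fixes v :: "real^2 \<Rightarrow> real"
  assumes diff: "\<And>x. v differentiable (at x)"
    and cont: "continuous_on UNIV (gradient v)"
    and supp: "\<And>x. B < norm x \<Longrightarrow> v x = 0"
  defines "u \<equiv> (\<lambda>x. bessel_J0 (norm x) * v x)"
  shows "dirichlet_energy u = mass u + (LINT x|lborel. (\<phi> x)\<^sup>2 * (norm (gradient v x))\<^sup>2)"
proof -
  let ?p = "gradient v"
  have dv: "(v has_derivative (\<lambda>h. h \<bullet> ?p x)) (at x)" for x
    by (rule has_derivative_gradient[OF diff])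
  have contv: "continuous_on UNIV v"
    by (intro differentiable_imp_continuous_on differentiable_at_imp_differentiable_on diff)
  have u: "u = (\<lambda>x. \<phi> x * v x)"
    by (simp add: u_def \<phi>_def bessel_J0_eq_G0)
  have gu: "gradient u x = (2 * G1 (x \<bullet> x) * v x) *\<^sub>R x + \<phi> x *\<^sub>R ?p x" for x
    unfolding u
    by (rule gradient_eqI, (rule derivative_eq_intros has_derivative_\<phi> dv refl)+)
      (simp add: inner_add_right inner_commute algebra_simps)
  \<comment> \<open>The field \<open>\<phi> v\<^sup>2 \<nabla>\<phi>\<close> has components \<open>g(x \<bullet> x) v(x)\<^sup>2 x\<^sub>i\<close>, because \<open>\<nabla>\<phi>(x) = 2 G1(x \<bullet> x) x\<close>.
    The derivative of the \<open>i\<close>th component in direction \<open>h\<close> is \<open>w' i x h\<close>.\<close>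
  define g where "g s = 2 * G0 s * G1 s" for s
  define g' where "g' s = 2 * ((G1 s)\<^sup>2 + G0 s * G2 s)" for s
  have dg: "((\<lambda>x. g (x \<bullet> x)) has_derivative (\<lambda>h. 2 * g' (x \<bullet> x) * (x \<bullet> h))) (at x)"
    for x :: "real^2"
  proof -
    have "((\<lambda>x. x \<bullet> x) has_derivative (\<lambda>h. 2 * (x \<bullet> h))) (at x)"
      by (rule derivative_eq_intros refl)+ (simp add: inner_commute)
    moreover have "(g has_real_derivative g' (x \<bullet> x)) (at (x \<bullet> x))"
      unfolding g_def[abs_def] g'_def
      by (rule derivative_eq_intros DERIV_G0 DERIV_G1 refl)+
        (simp add: power2_eq_square algebra_simps)
    ultimately have "((\<lambda>x. g (x \<bullet> x)) has_derivative (\<lambda>h. 2 * (x \<bullet> h) * g' (x \<bullet> x))) (at x)"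
      by (intro DERIV_compose_FDERIV)
    then show ?thesis by (simp add: mult_ac)
  qed
  define w' where "w' i x h = 2 * g' (x \<bullet> x) * (x \<bullet> h) * (v x)\<^sup>2 * (x $ i)
     + g (x \<bullet> x) * (2 * v x * (h \<bullet> ?p x)) * (x $ i) + g (x \<bullet> x) * (v x)\<^sup>2 * (h $ i)"
    for i :: 2 and x h
  have dw: "((\<lambda>x. g (x \<bullet> x) * (v x)\<^sup>2 * (x $ i)) has_derivative w' i x) (at x)" for i x
    unfolding w'_def[abs_def]
    by (rule derivative_eq_intros dg dv bounded_linear.has_derivative[OF bounded_linear_vec_nth] refl)+
      (simp add: power2_eq_square algebra_simps)
  have cw: "continuous_on UNIV (\<lambda>x. w' i x h)" for i h
    unfolding w'_def g_def g'_def by (intro continuous_intros contv cont)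
  have int: "integrable lborel (\<lambda>x. w' i x h)" "(LINT x|lborel. w' i x h) = 0" for i h
    using integral_directional_derivative_eq_0[OF dw cw, of B] supp by auto
  have pointwise: "(norm (gradient u x))\<^sup>2
      = (u x)\<^sup>2 + (\<phi> x)\<^sup>2 * (norm (?p x))\<^sup>2 + (w' 1 x (axis 1 1) + w' 2 x (axis 2 1))" for x
  proof -
    define s where "s = x \<bullet> x"
    define c where "c = x \<bullet> ?p x"
    have s: "x $ 1 * x $ 1 + x $ 2 * x $ 2 = s"
      by (simp add: s_def inner_vec_def UNIV_2)
    have c: "?p x $ 1 * x $ 1 + ?p x $ 2 * x $ 2 = c"
      by (simp add: c_def inner_vec_def UNIV_2 mult.commute)
    have "w' 1 x (axis 1 1) + w' 2 x (axis 2 1)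
        = 2 * g' s * (v x)\<^sup>2 * (x $ 1 * x $ 1 + x $ 2 * x $ 2)
          + 2 * g s * v x * (?p x $ 1 * x $ 1 + ?p x $ 2 * x $ 2) + 2 * g s * (v x)\<^sup>2"
      by (simp add: w'_def s_def[symmetric] inner_axis inner_axis' algebra_simps)
    then have w: "w' 1 x (axis 1 1) + w' 2 x (axis 2 1)
        = 2 * g' s * (v x)\<^sup>2 * s + 2 * g s * v x * c + 2 * g s * (v x)\<^sup>2"
      by (simp only: s c)
    have "(norm (gradient u x))\<^sup>2 = 4 * (G1 s)\<^sup>2 * (v x)\<^sup>2 * s
        + 4 * G1 s * v x * G0 s * c + (G0 s)\<^sup>2 * (norm (?p x))\<^sup>2"
      unfolding gu dot_square_norm[symmetric]
      by (simp add: inner_add inner_commute s_def[symmetric] c_def[symmetric] \<phi>_def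
          power2_eq_square algebra_simps)
    also have "\<dots> = (G0 s)\<^sup>2 * (norm (?p x))\<^sup>2
        + (2 * g' s * (v x)\<^sup>2 * s + 2 * g s * v x * c + 2 * g s * (v x)\<^sup>2)
        - G0 s * (v x)\<^sup>2 * (4 * s * G2 s + 4 * G1 s)"
      by (simp add: g_def g'_def power2_eq_square algebra_simps)
    also have "4 * s * G2 s + 4 * G1 s = - G0 s"
      using bessel_ODE[of s] by linarith
    finally show ?thesis
      by (simp add: w u \<phi>_def s_def[symmetric] power_mult_distrib power2_eq_square)
  qed
  have iu: "integrable lborel (\<lambda>x. (u x)\<^sup>2)"
    by (rule integrable_continuous_bounded_support[of _ B])
      (auto simp: u supp intro!: continuous_intros continuous_\<phi> contv)
  have ip: "integrable lborel (\<lambda>x. (\<phi> x)\<^sup>2 * (norm (?p x))\<^sup>2)"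
    by (rule integrable_continuous_bounded_support[of _ B])
      (use gradient_eq_0_outside[of B v] supp in \<open>auto intro!: continuous_intros continuous_\<phi> cont\<close>)
  show ?thesis
    unfolding dirichlet_energy_def mass_def pointwise
    using iu ip int by simp
qed

lemma mass_pos:
  fixes v :: "real^2 \<Rightarrow> real"
  assumes "v \<in> test_functions" "v x \<noteq> 0"
  shows "0 < mass (\<lambda>x. bessel_J0 (norm x) * v x)"
proof -
  obtain B where B: "\<And>x. B < norm x \<Longrightarrow> v x = 0"
    using test_function_bounded_support[OF assms(1)] by blast
  have "continuous_on UNIV v"
    by (intro differentiable_imp_continuous_on differentiable_at_imp_differentiable_on
        test_function_C1(1)[OF assms(1)])
  then have cv: "continuous_on UNIV (\<lambda>x. (v x)\<^sup>2)"
    by (intro continuous_intros)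
  have "mass (\<lambda>x. bessel_J0 (norm x) * v x) = (LINT x|lborel. (\<phi> x)\<^sup>2 * (v x)\<^sup>2)"
    by (simp add: mass_def \<phi>_def bessel_J0_eq_G0 power_mult_distrib)
  moreover have "\<dots> \<noteq> 0"
    using continuous_nonneg_\<phi>_integral_eq_0[OF cv, of B x] B assms(2) by auto
  moreover have "0 \<le> (LINT x|lborel. (\<phi> x)\<^sup>2 * (v x)\<^sup>2)"
    by (rule integral_nonneg_AE) simp
  ultimately show ?thesis by linarith
qed

text \<open>
  The excess \<open>\<integral>\<phi>\<^sup>2|\<nabla>v|\<^sup>2\<close> could vanish only for constant \<open>v\<close>, and the constant would be zero
  since \<open>v\<close> has compact support.
\<close>

lemma energy_gt_mass:
  fixes v :: "real^2 \<Rightarrow> real"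
  assumes "v \<in> test_functions" "v x \<noteq> 0"
  shows "mass (\<lambda>x. bessel_J0 (norm x) * v x) < dirichlet_energy (\<lambda>x. bessel_J0 (norm x) * v x)"
proof -
  let ?I = "LINT x|lborel. (\<phi> x)\<^sup>2 * (norm (gradient v x))\<^sup>2"
  note C1 = test_function_C1[OF assms(1)]
  obtain B where B: "\<And>x. B < norm x \<Longrightarrow> v x = 0"
    using test_function_bounded_support[OF assms(1)] by blast
  have "?I \<noteq> 0"
  proof
    assume "?I = 0"
    have "continuous_on UNIV (\<lambda>x. (norm (gradient v x))\<^sup>2)"
      by (intro continuous_intros C1)
    then have "(norm (gradient v y))\<^sup>2 = 0" for y
      by (rule continuous_nonneg_\<phi>_integral_eq_0[of _ B])
        (simp_all add: gradient_eq_0_outside[of B v] B \<open>?I = 0\<close>)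
    then have grad0: "gradient v y = 0" for y
      by simp
    have der0: "(v has_derivative (\<lambda>h. 0)) (at y)" for y
      using has_derivative_gradient[OF C1(1), of y] unfolding grad0 inner_zero_right .
    obtain z :: "real^2" where z: "norm z = \<bar>B\<bar> + 1"
      by (rule vector_choose_size[of "\<bar>B\<bar> + 1"]) simp
    have "v x = v z"
      by (rule has_derivative_zero_unique[of UNIV]) (simp_all add: der0)
    moreover have "v z = 0"
      by (rule B) (simp add: z)
    ultimately show False using assms(2) by simp
  qed
  moreover have "0 \<le> ?I"
    by (rule integral_nonneg_AE) simp
  moreover have "dirichlet_energy (\<lambda>x. bessel_J0 (norm x) * v x)
      = mass (\<lambda>x. bessel_J0 (norm x) * v x) + ?I"
    by (rule divergence_identity[OF C1, of B]) (rule B)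
  ultimately show ?thesis by linarith
qed

section \<open>Smooth bump functions\<close>

lemma C_k_SucI:
  assumes "\<And>x. (f has_derivative f' x) (at x)" "\<And>h. C_k k (\<lambda>x. f' x h)"
  shows "C_k (Suc k) f"
proof -
  have "frechet_derivative f (at x) = f' x" for x
    using frechet_derivative_at[OF assms(1)] by (rule sym)
  with assms show ?thesis by (auto simp: differentiable_def)
qed

lemma C_k_SucD:
  assumes "C_k (Suc k) f"
  shows "(f has_derivative frechet_derivative f (at x)) (at x)"
    "C_k k (\<lambda>x. frechet_derivative f (at x) h)"
  using assms by (auto simp: frechet_derivative_works)

lemma C_k_mono: "C_k (Suc k) f \<Longrightarrow> C_k k f"
proof (induction k arbitrary: f)
  case 0
  then show ?case
    using C_k_SucD(1) has_derivative_continuous continuous_at_imp_continuous_on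
    by (metis C_k.simps(1))
next
  case (Suc k)
  show ?case
    by (rule C_k_SucI[OF C_k_SucD(1)[OF Suc.prems]]) (rule Suc.IH[OF C_k_SucD(2)[OF Suc.prems]])
qed

lemma C_k_const: "C_k k (\<lambda>x. c)"
proof (induction k arbitrary: c)
  case (Suc k)
  show ?case by (rule C_k_SucI[OF has_derivative_const]) (rule Suc.IH)
qed simp

lemma C_k_inner_left: "C_k k (\<lambda>x. x \<bullet> h)"
proof (cases k)
  case (Suc k')
  show ?thesis unfolding Suc
    by (rule C_k_SucI[where f' = "\<lambda>x y. y \<bullet> h"])
      (auto intro!: derivative_eq_intros C_k_const)
qed (auto intro!: continuous_intros)

lemma C_k_add: "C_k k f \<Longrightarrow> C_k k g \<Longrightarrow> C_k k (\<lambda>x. f x + g x)"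
proof (induction k arbitrary: f g)
  case (Suc k)
  show ?case
    by (rule C_k_SucI[OF has_derivative_add[OF C_k_SucD(1) C_k_SucD(1)]])
      (use Suc C_k_SucD(2) in blast)+
qed (auto intro!: continuous_intros)

lemma C_k_mult: "C_k k f \<Longrightarrow> C_k k g \<Longrightarrow> C_k k (\<lambda>x. f x * g x)"
proof (induction k arbitrary: f g)
  case (Suc k)
  note f = Suc.prems(1) and g = Suc.prems(2)
  show ?case
  proof (rule C_k_SucI[OF has_derivative_mult[OF C_k_SucD(1)[OF f] C_k_SucD(1)[OF g]]])
    fix h
    show "C_k k (\<lambda>x. f x * frechet_derivative g (at x) h + frechet_derivative f (at x) h * g x)"
      by (rule C_k_add[OF Suc.IH[OF C_k_mono[OF f] C_k_SucD(2)[OF g]]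
            Suc.IH[OF C_k_SucD(2)[OF f] C_k_mono[OF g]]])
  qed
qed (auto intro!: continuous_intros)

text \<open>
  The functions \<open>t\<^sup>-\<^sup>n exp(-1/t)\<close>, extended by zero to \<open>t \<le> 0\<close>. The whole family is carried along
  because the derivative of a member is a combination of two others, which gives smoothness
  of all of them at once by induction on the order of differentiation.
\<close>

definition flat :: "nat \<Rightarrow> real \<Rightarrow> real" where
  "flat n t = (if t \<le> 0 then 0 else inverse t ^ n * exp (- inverse t))"

lemma tendsto_flat_at_right: "(flat n \<longlongrightarrow> 0) (at_right 0)"
proof -
  have "((\<lambda>t. inverse t ^ n / exp (inverse t)) \<longlongrightarrow> 0) (at_right (0::real))"
    by (rule filterlim_compose[OF tendsto_power_div_exp_0 filterlim_inverse_at_top_right])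
  moreover have "\<forall>\<^sub>F t in at_right 0. inverse t ^ n / exp (inverse t) = flat n t"
    using eventually_at_right_less[of "0::real"]
    by eventually_elim (simp add: flat_def exp_minus divide_inverse)
  ultimately show ?thesis by (rule Lim_transform_eventually)
qed

lemma DERIV_flat: "(flat n has_real_derivative flat (n + 2) t - n * flat (n + 1) t) (at t)"
proof -
  consider "t < 0" | "t = 0" | "0 < t" by linarith
  then show ?thesis
  proof cases
    case 1
    have "(flat n has_real_derivative 0) (at t)"
      by (rule has_field_derivative_transform_within_open[OF DERIV_const[of 0], of "{..<0}"])
        (use 1 in \<open>auto simp: flat_def\<close>)
    then show ?thesis using 1 by (simp add: flat_def)
  next
    case 2
    have "((\<lambda>h. flat n h / h) \<longlongrightarrow> 0) (at_left 0)"
      by (rule tendsto_eventually, rule eventually_at_leftI[of "-1"]) (auto simp: flat_def)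
    moreover have "((\<lambda>h. flat n h / h) \<longlongrightarrow> 0) (at_right 0)"
      by (rule Lim_transform_eventually[OF tendsto_flat_at_right[of "Suc n"]])
        (auto simp: flat_def divide_inverse intro!: eventually_at_rightI[of 0 1])
    ultimately have "((\<lambda>h. flat n h / h) \<longlongrightarrow> 0) (at 0)"
      by (simp add: filterlim_at_split)
    then show ?thesis using 2 by (simp add: DERIV_def flat_def)
  next
    case 3
    have "((\<lambda>t. inverse t ^ n * exp (- inverse t)) has_real_derivative
        real n * inverse t ^ (n - 1) * (- (inverse t * inverse t)) * exp (- inverse t)
        + exp (- inverse t) * (inverse t * inverse t) * inverse t ^ n) (at t)"
      using 3 by (auto intro!: derivative_eq_intros simp: power2_eq_square)
    also have "real n * inverse t ^ (n - 1) * (- (inverse t * inverse t)) * exp (- inverse t)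
        + exp (- inverse t) * (inverse t * inverse t) * inverse t ^ n
        = flat (n + 2) t - n * flat (n + 1) t"
      using 3 by (cases n) (simp_all add: flat_def algebra_simps)
    finally show ?thesis
      by (rule has_field_derivative_transform_within_open[of _ _ _ "{0<..}"]) (use 3 in \<open>auto simp: flat_def\<close>)
  qed
qed

lemma flat_0_le_1: "flat 0 t \<le> 1" and flat_nonneg: "0 \<le> flat n t"
  by (auto simp: flat_def)

lemma flat_2_le: "flat 2 t \<le> 2"
proof (cases "0 < t")
  case True
  let ?y = "inverse t"
  have "?y\<^sup>2 / 2 \<le> exp ?y"
    using exp_lower_Taylor_quadratic[of ?y] positive_imp_inverse_positive[OF True] by linarith
  then have "?y\<^sup>2 * exp (- ?y) \<le> 2 * exp ?y * exp (- ?y)"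
    by (intro mult_right_mono) auto
  also have "\<dots> = 2"
    by (simp only: mult.assoc exp_minus_inverse mult_1_right)
  finally show ?thesis using True by (simp add: flat_def)
qed (simp add: flat_def)

lemma flat_0_ge:
  assumes "1 / 2 \<le> t"
  shows "exp (-2) \<le> flat 0 t"
proof -
  have "inverse t \<le> 2" using le_imp_inverse_le[OF assms] by simp
  then show ?thesis using assms by (simp add: flat_def)
qed

definition bump :: "real \<Rightarrow> 'a::real_inner \<Rightarrow> real" where
  "bump R x = flat 0 (1 - x \<bullet> x / R\<^sup>2)"

lemma has_derivative_flat_quadratic:
  "((\<lambda>x. flat n (1 - x \<bullet> x / R\<^sup>2)) has_derivative
    (\<lambda>h. (flat (n + 2) (1 - x \<bullet> x / R\<^sup>2) + (- real n) * flat (n + 1) (1 - x \<bullet> x / R\<^sup>2))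
      * ((-2 / R\<^sup>2) * (x \<bullet> h)))) (at x)"
proof -
  have "((\<lambda>x. 1 - x \<bullet> x / R\<^sup>2) has_derivative (\<lambda>h. (-2 / R\<^sup>2) * (x \<bullet> h))) (at x)"
    by (cases "R = 0") (auto intro!: derivative_eq_intros simp: inner_commute field_simps)
  from DERIV_compose_FDERIV[OF DERIV_flat this, of n] show ?thesis
    by (simp add: mult_ac)
qed

lemma C_k_flat_quadratic: "C_k k (\<lambda>x. flat n (1 - x \<bullet> x / R\<^sup>2))"
proof (induction k arbitrary: n)
  case 0
  show ?case
    using has_derivative_continuous[OF has_derivative_flat_quadratic]
    by (auto intro!: continuous_at_imp_continuous_on)
next
  case (Suc k)
  have "C_k k (\<lambda>x. (flat (n + 2) (1 - x \<bullet> x / R\<^sup>2) + (- real n) * flat (n + 1) (1 - x \<bullet> x / R\<^sup>2))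
      * ((-2 / R\<^sup>2) * (x \<bullet> h)))" for h :: 'a
    by (intro C_k_mult C_k_add C_k_const C_k_inner_left Suc.IH)
  then show ?case
    by (rule C_k_SucI[OF has_derivative_flat_quadratic])
qed

lemma bump_outside:
  assumes "0 < R" "R < norm x"
  shows "bump R x = 0"
proof -
  have "R\<^sup>2 \<le> x \<bullet> x"
    using assms power_mono[of R "norm x" 2] by (simp add: dot_square_norm)
  then show ?thesis using assms by (simp add: bump_def flat_def field_simps)
qed

lemma gradient_bump_outside:
  fixes x :: "'a::euclidean_space"
  assumes "0 < R" "R < norm x"
  shows "gradient (bump R) x = 0"
  by (rule gradient_eq_0_outside[of R, OF bump_outside[OF assms(1)] assms(2)])

lemma bump_test_function:
  assumes "0 < R"
  shows "(bump R :: 'a::euclidean_space \<Rightarrow> real) \<in> test_functions"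
proof -
  have "support_on UNIV (bump R :: 'a \<Rightarrow> real) \<subseteq> cball 0 R"
    using bump_outside[OF assms] by (force simp: support_on_def)
  then have "compact (closure (support_on UNIV (bump R :: 'a \<Rightarrow> real)))"
    using bounded_subset bounded_cball compact_closure by blast
  then show ?thesis
    unfolding test_functions_def smooth_def bump_def[abs_def] by (simp add: C_k_flat_quadratic)
qed

lemma gradient_bump: "gradient (bump R) x = ((-2 / R\<^sup>2) * flat 2 (1 - x \<bullet> x / R\<^sup>2)) *\<^sub>R x"
proof (rule gradient_eqI)
  show "(bump R has_derivative (\<lambda>h. h \<bullet> (((-2 / R\<^sup>2) * flat 2 (1 - x \<bullet> x / R\<^sup>2)) *\<^sub>R x))) (at x)"
    using has_derivative_flat_quadratic[of 0 R x]
    by (simp add: bump_def[abs_def] inner_commute mult_ac numeral_2_eq_2)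
qed

section \<open>Sharpness of the constant\<close>

text \<open>
  How \<open>\<integral>\<phi>\<^sup>2\<close> over the disc of radius \<open>R\<close> grows decides the sharpness. The true rate is linear
  in \<open>R\<close>, but the bound by the area of the disc is enough, as the bump functions gain a
  factor \<open>1/R\<^sup>2\<close> at each doubling.
\<close>

definition disc_mass :: "real \<Rightarrow> real" where
  "disc_mass R = (LINT x|lborel. indicator (cball (0::real^2) R) x * (\<phi> x)\<^sup>2)"

lemma integrable_disc_mass:
  "integrable lborel (\<lambda>x. indicator (cball (0::real^2) R) x * (\<phi> x)\<^sup>2)"
proof -
  have "continuous_on (cball (0::real^2) R) (\<lambda>x. (\<phi> x)\<^sup>2)"
    by (intro continuous_on_power continuous_on_subset[OF continuous_\<phi> subset_UNIV])
  from borel_integrable_compact[OF compact_cball this] show ?thesis by simp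
qed

text \<open>
  Since \<open>|\<phi>| \<le> 1\<close>, the area of the disc is a bound.
\<close>

lemma disc_mass_le:
  assumes "0 \<le> R"
  shows "disc_mass R \<le> R\<^sup>2 * measure lborel (ball (0::real^2) 1)"
proof -
  have i: "integrable lborel (\<lambda>x. indicator (cball (0::real^2) R) x :: real)"
    by (intro integrable_real_indicator) (use emeasure_lborel_cball_finite in auto)
  have "disc_mass R \<le> (LINT x|lborel. indicator (cball (0::real^2) R) x)"
    unfolding disc_mass_def
    by (rule integral_mono[OF integrable_disc_mass i])
      (auto simp: indicator_def \<phi>_def intro!: G0_square_le_1)
  also have "\<dots> = measure lborel (cball (0::real^2) R)"
    by simp
  also have "\<dots> = R\<^sup>2 * measure lborel (ball (0::real^2) 1)"
    using content_ball_conv_unit_ball[OF assms, of "0::real^2"] by (simp add: content_cball_conv_ball)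
  finally show ?thesis .
qed

lemma continuous_bump: "continuous_on UNIV (bump R)"
  using C_k_flat_quadratic[of 0 0 R] by (simp add: bump_def[abs_def])

lemma mass_bump: "mass (\<lambda>x. bessel_J0 (norm x) * bump R x) = (LINT x::real^2|lborel. (\<phi> x)\<^sup>2 * (bump R x)\<^sup>2)"
  by (simp add: mass_def \<phi>_def bessel_J0_eq_G0 power_mult_distrib)

lemma integrable_mass_bump:
  assumes "0 < R"
  shows "integrable lborel (\<lambda>x::real^2. (\<phi> x)\<^sup>2 * (bump R x)\<^sup>2)"
  by (rule integrable_continuous_bounded_support[of _ R])
    (auto simp: bump_outside assms intro!: continuous_intros continuous_\<phi> continuous_bump)

lemma bump_0: "bump R 0 \<noteq> 0"
  by (simp add: bump_def flat_def)

lemma disc_mass_pos: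
  assumes "0 < R"
  shows "0 < disc_mass R"
proof -
  have "0 < mass (\<lambda>x. bessel_J0 (norm x) * bump R x)"
    by (rule mass_pos[OF bump_test_function[OF assms] bump_0])
  also have "\<dots> \<le> disc_mass R"
    unfolding mass_bump disc_mass_def
  proof (rule integral_mono[OF integrable_mass_bump[OF assms] integrable_disc_mass])
    fix x :: "real^2"
    have "(bump R x)\<^sup>2 \<le> 1"
      using flat_0_le_1 flat_nonneg[of 0] by (simp add: bump_def power_le_one)
    then have "(\<phi> x)\<^sup>2 * (bump R x)\<^sup>2 \<le> (\<phi> x)\<^sup>2" by (simp add: mult_left_le)
    then show "(\<phi> x)\<^sup>2 * (bump R x)\<^sup>2 \<le> indicator (cball 0 R) x * (\<phi> x)\<^sup>2"
      using bump_outside[OF assms, of x] by (auto simp: indicator_def)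
  qed
  finally show ?thesis .
qed

text \<open>
  On the disc of radius \<open>R/2\<close> the bump is at least \<open>flat 0 (3/4) \<ge> exp(-2)\<close>.
\<close>

lemma mass_bump_ge:
  assumes "0 < R"
  shows "(exp (-2))\<^sup>2 * disc_mass (R / 2) \<le> mass (\<lambda>x. bessel_J0 (norm x) * bump R x)"
proof -
  have "(exp (-2))\<^sup>2 * disc_mass (R / 2)
      = (LINT x|lborel. (exp (-2))\<^sup>2 * (indicator (cball (0::real^2) (R / 2)) x * (\<phi> x)\<^sup>2))"
    by (simp add: disc_mass_def)
  also have "\<dots> \<le> mass (\<lambda>x. bessel_J0 (norm x) * bump R x)"
    unfolding mass_bump
  proof (rule integral_mono[OF integrable_mult_right[OF integrable_disc_mass] integrable_mass_bump[OF assms]])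
    fix x :: "real^2"
    show "(exp (-2))\<^sup>2 * (indicator (cball 0 (R / 2)) x * (\<phi> x)\<^sup>2) \<le> (\<phi> x)\<^sup>2 * (bump R x)\<^sup>2"
    proof (cases "norm x \<le> R / 2")
      case True
      have "x \<bullet> x \<le> (R / 2)\<^sup>2"
        using power_mono[OF True, of 2] by (simp add: dot_square_norm)
      then have "x \<bullet> x * 4 \<le> R\<^sup>2"
        by (simp add: power_divide)
      then have "x \<bullet> x * 2 \<le> R\<^sup>2"
        using inner_ge_zero[of x] by linarith
      then have "1 / 2 \<le> 1 - x \<bullet> x / R\<^sup>2"
        using assms \<open>x \<bullet> x * 2 \<le> R\<^sup>2\<close> by (simp add: field_simps)
      then have "(exp (-2))\<^sup>2 \<le> (bump R x)\<^sup>2"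
        unfolding bump_def by (intro power_mono flat_0_ge) auto
      from mult_left_mono[OF this, of "(\<phi> x)\<^sup>2"] True show ?thesis
        by (simp add: mult.commute)
    qed simp
  qed
  finally show ?thesis .
qed

text \<open>
  The gradient of the bump has norm at most \<open>(2/R\<^sup>2) * 2 * R = 4/R\<close>, because \<open>flat 2 \<le> 2\<close>.
\<close>

lemma weighted_gradient_bump_le:
  assumes "0 < R"
  shows "(LINT x|lborel. (\<phi> (x::real^2))\<^sup>2 * (norm (gradient (bump R) x))\<^sup>2) \<le> 16 / R\<^sup>2 * disc_mass R"
proof -
  have i: "integrable lborel (\<lambda>x. (\<phi> (x::real^2))\<^sup>2 * (norm (gradient (bump R) x))\<^sup>2)"
  proof (rule integrable_continuous_bounded_support[of _ R])
    show "continuous_on UNIV (\<lambda>x::real^2. (\<phi> x)\<^sup>2 * (norm (gradient (bump R) x))\<^sup>2)"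
      by (intro continuous_intros continuous_\<phi> test_function_C1 bump_test_function assms)
    show "(\<phi> x)\<^sup>2 * (norm (gradient (bump R) x))\<^sup>2 = 0" if "R < norm x" for x :: "real^2"
      by (simp add: gradient_bump_outside[OF assms that])
  qed
  have "(LINT x|lborel. (\<phi> (x::real^2))\<^sup>2 * (norm (gradient (bump R) x))\<^sup>2)
      \<le> (LINT x|lborel. 16 / R\<^sup>2 * (indicator (cball (0::real^2) R) x * (\<phi> x)\<^sup>2))"
  proof (rule integral_mono[OF i integrable_mult_right[OF integrable_disc_mass]])
    fix x :: "real^2"
    show "(\<phi> x)\<^sup>2 * (norm (gradient (bump R) x))\<^sup>2
        \<le> 16 / R\<^sup>2 * (indicator (cball 0 R) x * (\<phi> x)\<^sup>2)"
    proof (cases "norm x \<le> R")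
      case True
      have "norm (gradient (bump R) x) = 2 / R\<^sup>2 * flat 2 (1 - x \<bullet> x / R\<^sup>2) * norm x"
        using flat_nonneg[of 2] by (simp add: gradient_bump abs_mult)
      also have "\<dots> \<le> 2 / R\<^sup>2 * 2 * R"
        using flat_2_le flat_nonneg True by (intro mult_mono mult_left_mono) auto
      also have "\<dots> = 4 / R"
        using assms by (simp add: power2_eq_square)
      finally have "(norm (gradient (bump R) x))\<^sup>2 \<le> (4 / R)\<^sup>2"
        by (intro power_mono) auto
      from mult_left_mono[OF this, of "(\<phi> x)\<^sup>2"] True show ?thesis
        by (simp add: power_divide mult.commute)
    next
      case False
      then show ?thesis
        by (simp add: gradient_bump_outside[OF assms])
    qed
  qed
  then show ?thesis by (simp add: disc_mass_def)
qed

text \<open>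
  Otherwise the two estimates for bumps give \<open>disc_mass (R/2) \<le> (K/R\<^sup>2) disc_mass R\<close> with a fixed
  \<open>K\<close> for all \<open>R\<close>. For large \<open>R\<close> this multiplies the mass by at least 8 whenever the radius is
  doubled, while the area of the disc is only multiplied by 4.
\<close>

lemma almost_minimizing_bump:
  assumes "0 < \<epsilon>"
  obtains R where "0 < R"
    "dirichlet_energy (\<lambda>x. bessel_J0 (norm x) * bump R x)
      \<le> (1 + \<epsilon>) * mass (\<lambda>x. bessel_J0 (norm x) * bump R x)"
proof (rule ccontr)
  assume "\<not> thesis"
  with that have large: "(1 + \<epsilon>) * mass (\<lambda>x. bessel_J0 (norm x) * bump R x)
      < dirichlet_energy (\<lambda>x. bessel_J0 (norm x) * bump R x)" if "0 < R" for R
    using that by fastforce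
  define c :: real where "c = (exp (-2))\<^sup>2"
  have "0 < c" by (simp add: c_def)
  \<comment> \<open>Chosen so that \<open>16 / (\<epsilon> c R\<^sup>2) \<le> 1/8\<close> for \<open>R \<ge> R0\<close>.\<close>
  define R0 where "R0 = sqrt (128 / (\<epsilon> * c))"
  have R0: "0 < R0" "R0\<^sup>2 = 128 / (\<epsilon> * c)"
    using assms \<open>0 < c\<close> by (auto simp: R0_def)
  have octuple: "8 * disc_mass (R / 2) \<le> disc_mass R" if "R0 \<le> R" for R
  proof -
    have R: "0 < R" using R0 that by linarith
    let ?m = "mass (\<lambda>x. bessel_J0 (norm x) * bump R x)"
    have "dirichlet_energy (\<lambda>x. bessel_J0 (norm x) * bump R x)
        = ?m + (LINT x::real^2|lborel. (\<phi> x)\<^sup>2 * (norm (gradient (bump R) x))\<^sup>2)"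
      by (rule divergence_identity[OF test_function_C1[OF bump_test_function[OF R]]])
        (rule bump_outside[OF R])
    then have "\<epsilon> * ?m \<le> 16 / R\<^sup>2 * disc_mass R"
      using large[OF R] weighted_gradient_bump_le[OF R] by (simp add: algebra_simps)
    moreover have "\<epsilon> * (c * disc_mass (R / 2)) \<le> \<epsilon> * ?m"
      using mass_bump_ge[OF R] assms by (simp add: c_def)
    ultimately have "\<epsilon> * (c * disc_mass (R / 2)) \<le> 16 / R\<^sup>2 * disc_mass R"
      by (rule order_trans[rotated])
    then have 1: "\<epsilon> * c * R\<^sup>2 * disc_mass (R / 2) \<le> 16 * disc_mass R"
      using R by (simp add: field_simps)
    have "128 \<le> \<epsilon> * c * R\<^sup>2"
      using power_mono[OF that, of 2] R0 assms \<open>0 < c\<close> by (simp add: field_simps)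
    then have "128 * disc_mass (R / 2) \<le> \<epsilon> * c * R\<^sup>2 * disc_mass (R / 2)"
      using disc_mass_pos[of "R / 2"] R by (intro mult_right_mono) auto
    with 1 show ?thesis by linarith
  qed
  have growth: "8 ^ n * disc_mass R0 \<le> disc_mass (2 ^ n * R0)" for n
  proof (induction n)
    case (Suc n)
    have "R0 * 1 \<le> R0 * 2 ^ Suc n"
      using R0 by (intro mult_left_mono one_le_power) auto
    then have "8 * disc_mass (2 ^ Suc n * R0 / 2) \<le> disc_mass (2 ^ Suc n * R0)"
      by (intro octuple) (simp add: mult.commute)
    with Suc show ?case by simp
  qed simp
  define B where "B = R0\<^sup>2 * measure lborel (ball (0::real^2) 1)"
  have "2 ^ n * disc_mass R0 \<le> B" for n
  proof -
    have "8 ^ n * disc_mass R0 \<le> (2 ^ n * R0)\<^sup>2 * measure lborel (ball (0::real^2) 1)"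
      using growth[of n] disc_mass_le[of "2 ^ n * R0"] R0 by force
    also have "\<dots> = 4 ^ n * B"
      by (simp add: B_def power_mult_distrib power2_eq_square flip: power_mult_distrib)
    finally have "4 ^ n * (2 ^ n * disc_mass R0) \<le> 4 ^ n * B"
      by (simp flip: power_mult_distrib mult.assoc)
    then show ?thesis by simp
  qed
  moreover obtain n where "B / disc_mass R0 < 2 ^ n"
    using real_arch_pow[of 2 "B / disc_mass R0"] by auto
  ultimately show False
    using disc_mass_pos[OF R0(1)] by (simp add: divide_less_eq) (meson not_le)
qed

lemma admissible_bump:
  assumes "0 < R"
  shows "(\<lambda>x. bessel_J0 (norm x) * bump R x) \<in> admissible"
  unfolding admissible_def using bump_test_function[OF assms] bump_0[of R] by blast

lemma admissible_energy:
  assumes "u \<in> admissible"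
  shows "0 < mass u" "mass u < dirichlet_energy u"
  using assms mass_pos energy_gt_mass unfolding admissible_def by auto

lemma lower_bound_le_1:
  assumes "\<And>u. u \<in> admissible \<Longrightarrow> C * mass u < dirichlet_energy u"
  shows "C \<le> 1"
proof (rule ccontr)
  assume "\<not> C \<le> 1"
  then have "0 < C - 1" by simp
  then obtain R where "0 < R"
    "dirichlet_energy (\<lambda>x. bessel_J0 (norm x) * bump R x)
      \<le> (1 + (C - 1)) * mass (\<lambda>x. bessel_J0 (norm x) * bump R x)"
    by (rule almost_minimizing_bump)
  with assms[OF admissible_bump[OF \<open>0 < R\<close>]] show False by simp
qed

theorem mainTheorem9:
  shows "(\<forall>v :: real^2 \<Rightarrow> real. v \<in> test_functions \<and> (\<exists>x. v x \<noteq> 0) \<longrightarrow>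
            (let u = (\<lambda>x. bessel_J0 (norm x) * v x)
             in dirichlet_energy u > mass u))
         \<and> is_best_constant 1
         \<and> \<not> (\<exists>u. is_minimizer u)"
proof (intro conjI)
  show "\<forall>v :: real^2 \<Rightarrow> real. v \<in> test_functions \<and> (\<exists>x. v x \<noteq> 0) \<longrightarrow>
      (let u = (\<lambda>x. bessel_J0 (norm x) * v x) in dirichlet_energy u > mass u)"
    using energy_gt_mass by (auto simp: Let_def)
  show "is_best_constant 1"
    unfolding is_best_constant_def using admissible_energy lower_bound_le_1 by auto
  show "\<not> (\<exists>u. is_minimizer u)"
  proof
    assume "\<exists>u. is_minimizer u"
    then obtain u where u: "u \<in> admissible"
      and min: "\<And>w. w \<in> admissible \<Longrightarrow> dirichlet_energy u / mass u \<le> dirichlet_energy w / mass w"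
      unfolding is_minimizer_def by blast
    define q where "q = dirichlet_energy u / mass u"
    have "1 < q"
      using admissible_energy[OF u] by (simp add: q_def less_divide_eq)
    \<comment> \<open>The attained minimum \<open>q\<close> satisfies only a weak inequality; any constant strictly between
      1 and \<open>q\<close> satisfies the strict one and contradicts sharpness.\<close>
    have "(1 + q) / 2 * mass w < dirichlet_energy w" if w: "w \<in> admissible" for w
    proof -
      have "(1 + q) / 2 * mass w < q * mass w"
        using \<open>1 < q\<close> admissible_energy(1)[OF w] by (intro mult_strict_right_mono) auto
      also have "\<dots> \<le> dirichlet_energy w"
        using min[OF w] admissible_energy(1)[OF w] by (simp add: q_def le_divide_eq)
      finally show ?thesis .
    qed
    from lower_bound_le_1[OF this] \<open>1 < q\<close> show False by simp
  qed
qed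

end
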